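(* Let $\varepsilon>0$ and $p\in(0,1]$. There exists $n_0=n_0(\varepsilon,p)$ such that the following holds. Let $G$ be a bipartite graph with bipartition $(X,Y)$, $|X|=|Y|=n$ (so $|V(G)|=2n$), such that the pair $(X,Y)$ is $\varepsilon$-regular with density $p$. If $2n>n_0$, then \[ (1-3\sqrt\varepsilon)\,n\log (pn)\;\leq\; \log\mathsf{NM}(G,\sqrt\varepsilon)\;\leq\; (1+3\sqrt\varepsilon)\,n\log (pn). \]
   Context: All logarithms are natural. A matching $\mathcal M$ in a graph $G$ is maximal if it is not properly contained in another matching. For $\eta>0$, a maximal $\eta$-near perfect matching of $G$ is a maximal matching $\mathcal M$ with $|\mathcal M|\ge (1-\eta)|V(G)|/2$ (equivalently, covering at least $(1-\eta)|V(G)|$ vertices). $\mathsf{NM}(G,\eta)$ denotes the number of maximal $\eta$-near perfect matchings of $G$. For disjoint vertex sets $A,B$, $d(A,B)=\mathsf{e}(A,B)/(|A||B|)$, where $\mathsf{e}(A,B)$ is the number of edges between $A$ and $B$. A pair $(X,Y)$ is $\varepsilon$-regular with density $p$ if for all $X'\subseteq X$, $Y'\subseteq Y$ with $|X'|\ge\varepsilon|X|$ and $|Y'|\ge\varepsilon|Y|$ we have $|d(X',Y')-p|\le\varepsilon$.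
   Formalization: The lower bound is claimed only for ε < p or ε ≥ 1 (with NM > 0); for p ≤ ε < 1 it is false, since the empty bipartite graph is ε-regular with density p but has no near-perfect matching, so NM = 0. The upper bound is proved for all ε and p. *)

theory Defs
  imports Complex_Main
begin

text \<open>Finite simple graphs are given by a vertex set \<open>V\<close> and a set \<open>E\<close> of two-element
  subsets of \<open>V\<close>.\<close>

definition simple_graph :: "'a set \<Rightarrow> 'a set set \<Rightarrow> bool" where
  "simple_graph V E \<longleftrightarrow> finite V \<and> (\<forall>e\<in>E. e \<subseteq> V \<and> card e = 2)"

definition bipartition :: "'a set \<Rightarrow> 'a set set \<Rightarrow> 'a set \<Rightarrow> 'a set \<Rightarrow> bool" where
  "bipartition V E X Y \<longleftrightarrow>
     X \<union> Y = V \<and> X \<inter> Y = {} \<and> (\<forall>e\<in>E. \<exists>x\<in>X. \<exists>y\<in>Y. e = {x, y})"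

definition edges_between :: "'a set set \<Rightarrow> 'a set \<Rightarrow> 'a set \<Rightarrow> nat" where
  "edges_between E A B = card {e \<in> E. \<exists>a\<in>A. \<exists>b\<in>B. e = {a, b}}"

text \<open>For an empty \<open>A\<close> or \<open>B\<close> the value is \<open>0\<close>.\<close>

definition density :: "'a set set \<Rightarrow> 'a set \<Rightarrow> 'a set \<Rightarrow> real" where
  "density E A B = real (edges_between E A B) / (real (card A) * real (card B))"

definition regular_pair :: "'a set set \<Rightarrow> 'a set \<Rightarrow> 'a set \<Rightarrow> real \<Rightarrow> real \<Rightarrow> bool" where
  "regular_pair E X Y \<epsilon> p \<longleftrightarrow>
     (\<forall>X' Y'. X' \<subseteq> X \<and> Y' \<subseteq> Y
        \<and> real (card X') \<ge> \<epsilon> * real (card X) \<and> real (card Y') \<ge> \<epsilon> * real (card Y)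
        \<longrightarrow> \<bar>density E X' Y' - p\<bar> \<le> \<epsilon>)"

definition matching :: "'a set set \<Rightarrow> 'a set set \<Rightarrow> bool" where
  "matching E M \<longleftrightarrow> M \<subseteq> E \<and> pairwise disjnt M"

definition maximal_matching :: "'a set set \<Rightarrow> 'a set set \<Rightarrow> bool" where
  "maximal_matching E M \<longleftrightarrow> matching E M \<and> \<not> (\<exists>N. matching E N \<and> M \<subset> N)"

definition maximal_near_perfect_matching ::
    "'a set \<Rightarrow> 'a set set \<Rightarrow> real \<Rightarrow> 'a set set \<Rightarrow> bool" where
  "maximal_near_perfect_matching V E \<eta> M \<longleftrightarrow>
     maximal_matching E M \<and> real (card M) \<ge> (1 - \<eta>) * real (card V) / 2"

definition NM :: "'a set \<Rightarrow> 'a set set \<Rightarrow> real \<Rightarrow> nat" where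
  "NM V E \<eta> = card {M. maximal_near_perfect_matching V E \<eta> M}"

end

theory Submission
  imports Defs "HOL-Library.FuncSet" "HOL-Real_Asymp.Real_Asymp"
begin

text \<open>As \<open>p\<close> and \<open>\<epsilon>\<close> are fixed, \<open>ln (p * n)\<close> may be replaced by \<open>ln n\<close> at a cost of \<open>O(n)\<close> in the
  logarithm of the count. The upper bound then holds for all matchings of any bipartite graph, there
  being at most \<open>(n + 1)^n\<close>.

  For the lower bound with \<open>\<epsilon> < p\<close>, the vertices missed by a matching of size \<open>m\<close> form two sets of
  size \<open>n - m\<close>; as long as this is at least \<open>\<epsilon> * n\<close>, regularity gives at least
  \<open>(p - \<epsilon>) * (\<epsilon> * n)\<^sup>2\<close> edges that extend the matching. So every maximal matching is near perfect, and
  double counting the extensions shows that there are at least \<open>(c * n)^m\<close> matchings of size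
  \<open>m = \<lceil>(1 - \<epsilon>) * n\<rceil>\<close>. Each lies in a maximal matching, and a maximal matching contains at most
  \<open>2^n\<close> of them.\<close>

section \<open>Extensions of matchings and double counting\<close>

definition matchings_of_size :: "'a set set \<Rightarrow> nat \<Rightarrow> 'a set set set" where
  "matchings_of_size E m = {M. matching E M \<and> card M = m}"

lemma finite_matchings: "finite E \<Longrightarrow> finite {M. matching E M}"
  by (rule finite_subset[of _ "Pow E"]) (auto simp: matching_def)

lemma finite_matchings_of_size: "finite E \<Longrightarrow> finite (matchings_of_size E m)"
  by (rule finite_subset[OF _ finite_matchings]) (auto simp: matchings_of_size_def)

lemma simple_graph_finite_edges: "simple_graph V E \<Longrightarrow> finite E"
  by (rule finite_subset[of _ "Pow V"]) (auto simp: simple_graph_def)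

lemma matching_insert:
  assumes "matching E M" "e \<in> E" "disjnt e (\<Union>M)"
  shows "matching E (insert e M)"
  using assms by (auto simp: matching_def pairwise_insert disjnt_def)

lemma matching_extends_to_maximal:
  assumes "finite E" "matching E M"
  obtains N where "maximal_matching E N" "M \<subseteq> N"
proof -
  have "\<exists>N\<in>{N. matching E N}. M \<subseteq> N \<and> (\<forall>b\<in>{N. matching E N}. N \<subseteq> b \<longrightarrow> N = b)"
    using finite_has_maximal2[OF finite_matchings[OF assms(1)], of M] assms(2) by auto
  then show thesis
    using that by (auto simp: maximal_matching_def)
qed

text \<open>Double counting: a pair of an \<open>m\<close>-matching \<open>M\<close> and an
  extending edge \<open>e\<close> is sent to the pair of \<open>insert e M\<close> and its member
  \<open>e\<close>. Each matching of size \<open>Suc m\<close> offers \<open>Suc m\<close> choices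
  of \<open>e\<close>.\<close>

lemma card_matchings_of_size_Suc:
  fixes t :: real
  assumes "finite E" "{} \<notin> E"
    and ext: "\<And>M. M \<in> matchings_of_size E m \<Longrightarrow> t \<le> card {e \<in> E. disjnt e (\<Union>M)}"
  shows "card (matchings_of_size E m) * t \<le> Suc m * card (matchings_of_size E (Suc m))"
proof -
  let ?P = "SIGMA M:matchings_of_size E m. {e \<in> E. disjnt e (\<Union>M)}"
  let ?Q = "SIGMA N:matchings_of_size E (Suc m). N"
  let ?f = "\<lambda>(M, e). (insert e M, e)"
  have finM: "finite M" if "matching E M" for M
    using that assms(1) finite_subset by (auto simp: matching_def)
  \<comment> \<open>An empty edge would be disjoint from every set and could already lie in
    \<open>M\<close>; \<open>{} \<notin> E\<close> excludes it.\<close>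
  have new: "e \<notin> M" if "e \<in> E" "disjnt e (\<Union>M)" for e M
    using that assms(2) by (metis Union_upper disjnt_iff disjnt_self_iff_empty subsetD)
  have "inj_on ?f ?P"
    using new unfolding inj_on_def by clarsimp (metis insert_ident disjnt_Union2)
  moreover have "?f ` ?P \<subseteq> ?Q"
    using new finM by (auto simp: matchings_of_size_def matching_insert)
  moreover have "finite ?Q"
    using finM by (intro finite_SigmaI finite_matchings_of_size assms(1))
      (auto simp: matchings_of_size_def)
  ultimately have "card ?P \<le> card ?Q"
    by (rule card_inj_on_le)
  also have "card ?Q = Suc m * card (matchings_of_size E (Suc m))"
    using finM finite_matchings_of_size[OF assms(1)]
    by (subst card_SigmaI) (auto simp: matchings_of_size_def)
  finally have "real (card ?P) \<le> Suc m * card (matchings_of_size E (Suc m))"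
    by (simp only: of_nat_mult[symmetric] of_nat_le_iff)
  moreover have "real (card ?P) = (\<Sum>M\<in>matchings_of_size E m. real (card {e \<in> E. disjnt e (\<Union>M)}))"
    using finite_matchings_of_size[OF assms(1)] assms(1) by (subst card_SigmaI) auto
  moreover have "(\<Sum>M\<in>matchings_of_size E m. t) \<le> \<dots>"
    by (rule sum_mono) (rule ext)
  ultimately show ?thesis
    by simp
qed

section \<open>Matchings in bipartite graphs\<close>

lemma bipartition_sym: "bipartition V E X Y \<Longrightarrow> bipartition V E Y X"
proof -
  assume b: "bipartition V E X Y"
  have "\<exists>y\<in>Y. \<exists>x\<in>X. e = {y, x}" if e: "e \<in> E" for e
  proof -
    obtain x y where "x \<in> X" "y \<in> Y" "e = {x, y}"
      using b e unfolding bipartition_def by blast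
    then show ?thesis
      by (metis insert_commute)
  qed
  then show ?thesis
    using b by (simp add: bipartition_def Un_commute Int_commute)
qed

lemma bipartition_no_empty_edge: "bipartition V E X Y \<Longrightarrow> {} \<notin> E"
  by (auto simp: bipartition_def)

text \<open>Each edge of \<open>M\<close> meets \<open>X\<close> in one vertex, and distinct edges
  in different ones. With \<open>bipartition_sym\<close> this also gives the number of vertices
  missed on either side.\<close>

lemma card_matching_covered:
  assumes "finite E" "bipartition V E X Y" "matching E M"
  shows "card (X \<inter> \<Union>M) = card M"
proof -
  have M: "finite M" "M \<subseteq> E" "pairwise disjnt M"
    using assms finite_subset by (auto simp: matching_def)
  have one: "card (X \<inter> e) = 1" if e: "e \<in> M" for e
  proof -
    obtain x y where "x \<in> X" "y \<in> Y" "e = {x, y}"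
      using e M(2) assms(2) unfolding bipartition_def by (meson subsetD)
    then have "X \<inter> e = {x}"
      using assms(2) by (auto simp: bipartition_def)
    then show ?thesis
      by simp
  qed
  have "card (X \<inter> \<Union>M) = card (\<Union>e\<in>M. X \<inter> e)"
    by (simp only: Int_Union)
  also have "\<dots> = (\<Sum>e\<in>M. card (X \<inter> e))"
  proof (rule card_UN_disjoint[OF M(1)])
    show "\<forall>e\<in>M. finite (X \<inter> e)"
      using one by (metis card.infinite zero_neq_one)
    show "\<forall>e\<in>M. \<forall>f\<in>M. e \<noteq> f \<longrightarrow> (X \<inter> e) \<inter> (X \<inter> f) = {}"
      using M(3) by (auto simp: pairwise_def disjnt_def)
  qed
  also have "\<dots> = card M"
    using one by simp
  finally show ?thesis .
qed

text \<open>A matching is determined by its edge, if any, at each vertex of \<open>X\<close>, which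
  leaves at most \<open>Suc (card Y)\<close> options per vertex.\<close>

lemma card_matchings_le:
  assumes "finite E" "bipartition V E X Y" "finite X" "finite Y"
  shows "card {M. matching E M} \<le> Suc (card Y) ^ card X"
proof -
  \<comment> \<open>The options are sets of edges, with \<open>{}\<close> for an uncovered vertex,
    so that the union of the chosen values is the matching itself.\<close>
  let ?B = "\<lambda>x. insert {} ((\<lambda>y. {{x, y}}) ` Y)"
  have "{M. matching E M} \<subseteq> (\<lambda>f. \<Union>(f ` X)) ` Pi\<^sub>E X ?B"
  proof
    fix M assume "M \<in> {M. matching E M}"
    then have M: "M \<subseteq> E" "pairwise disjnt M"
      by (auto simp: matching_def)
    define f where "f = restrict (\<lambda>x. {e \<in> M. x \<in> e}) X"
    have "f x \<in> ?B x" if x: "x \<in> X" for x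
    proof (cases "f x = {}")
      case False
      then obtain e where e: "e \<in> M" "x \<in> e"
        using x by (auto simp: f_def)
      then obtain u y where "u \<in> X" "y \<in> Y" "e = {u, y}"
        using M(1) assms(2) unfolding bipartition_def by (meson subsetD)
      then have "y \<in> Y" "e = {x, y}"
        using e x assms(2) by (auto simp: bipartition_def)
      moreover have "f x = {e}"
        using e x M(2) by (auto simp: f_def pairwise_def disjnt_def)
      ultimately show ?thesis
        by blast
    qed simp
    then have "f \<in> Pi\<^sub>E X ?B"
      by (auto simp: f_def PiE_def extensional_def Pi_def)
    moreover have "M = \<Union>(f ` X)"
    proof -
      have "\<exists>x\<in>X. x \<in> e" if "e \<in> M" for e
        using that M(1) assms(2) unfolding bipartition_def by blast
      then show ?thesis
        by (auto simp: f_def)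
    qed
    ultimately show "M \<in> (\<lambda>f. \<Union>(f ` X)) ` Pi\<^sub>E X ?B"
      by blast
  qed
  moreover have "finite (Pi\<^sub>E X ?B)"
    using assms by (intro finite_PiE) auto
  ultimately have "card {M. matching E M} \<le> card (Pi\<^sub>E X ?B)"
    by (metis surj_card_le)
  also have "\<dots> = (\<Prod>x\<in>X. card (?B x))"
    by (rule card_PiE[OF assms(3)])
  also have "\<dots> \<le> (\<Prod>x\<in>X. Suc (card Y))"
  proof (rule prod_mono, rule conjI)
    fix x
    have "card (?B x) \<le> Suc (card ((\<lambda>y. {{x, y}}) ` Y))"
      by (rule card_insert_le_m1) simp_all
    also have "\<dots> \<le> Suc (card Y)"
      using card_image_le[OF assms(4)] by simp
    finally show "card (?B x) \<le> Suc (card Y)" .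
  qed simp
  finally show ?thesis
    by simp
qed

section \<open>Matchings in regular pairs\<close>

text \<open>The uncovered parts of \<open>X\<close> and \<open>Y\<close> both have
  \<open>n - card M\<close> vertices, enough for regularity to apply, and every edge between them
  extends \<open>M\<close>.\<close>

lemma card_extending_edges_ge:
  fixes \<epsilon> p :: real
  assumes "simple_graph V E" "bipartition V E X Y" "card X = n" "card Y = n"
    and "regular_pair E X Y \<epsilon> p" and "matching E M" "\<epsilon> * n \<le> n - real (card M)"
    and "0 < \<epsilon>" "0 < n" "\<epsilon> < p"
  shows "(p - \<epsilon>) * (\<epsilon> * n)\<^sup>2 \<le> card {e \<in> E. disjnt e (\<Union>M)}"
proof -
  let ?X = "X - \<Union>M" and ?Y = "Y - \<Union>M"
  have finE: "finite E"
    using assms(1) by (rule simple_graph_finite_edges)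
  have fin: "finite X" "finite Y"
    using assms(3,4,9) card_ge_0_finite by metis+
  have "card ?X = n - card M" "card ?Y = n - card M"
    using card_matching_covered[OF finE assms(2,6)] assms(3,4)
      card_matching_covered[OF finE bipartition_sym[OF assms(2)] assms(6)] fin
    by (simp_all add: card_Diff_subset_Int)
  \<comment> \<open>Without this the truncated difference of naturals could not be read as a real
    difference.\<close>
  moreover have "card M \<le> n"
    using assms(7-9) by (smt (verit) mult_nonneg_nonneg of_nat_0_le_iff of_nat_le_iff)
  ultimately have card: "real (card ?X) = n - real (card M)" "real (card ?Y) = n - real (card M)"
    by simp_all
  have pos: "0 < \<epsilon> * n"
    using assms by simp
  have "\<bar>density E ?X ?Y - p\<bar> \<le> \<epsilon>"
    using assms(3-5,7) card unfolding regular_pair_def by (metis Diff_subset)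
  then have "p - \<epsilon> \<le> edges_between E ?X ?Y / (n - real (card M))\<^sup>2"
    unfolding density_def card by (simp add: power2_eq_square abs_le_iff)
  then have "(p - \<epsilon>) * (n - real (card M))\<^sup>2 \<le> edges_between E ?X ?Y"
    using pos assms(7) by (subst (asm) pos_le_divide_eq) simp_all
  moreover have "(p - \<epsilon>) * (\<epsilon> * n)\<^sup>2 \<le> (p - \<epsilon>) * (n - real (card M))\<^sup>2"
    using assms pos by (intro mult_left_mono power_mono) auto
  moreover have "edges_between E ?X ?Y \<le> card {e \<in> E. disjnt e (\<Union>M)}"
    unfolding edges_between_def
    by (rule card_mono) (use finE in \<open>auto simp: disjnt_def\<close>)
  ultimately show ?thesis
    by (smt (verit) of_nat_le_iff)
qed

text \<open>A smaller matching leaves at least \<open>\<epsilon> * n\<close> vertices uncovered on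
  each side, hence an edge by which it can be enlarged.\<close>

lemma regular_pair_maximal_matching_large:
  fixes \<epsilon> p :: real
  assumes "simple_graph V E" "bipartition V E X Y" "card X = n" "card Y = n"
    and "regular_pair E X Y \<epsilon> p" and "maximal_matching E M"
    and "0 < \<epsilon>" "0 < n" "\<epsilon> < p"
  shows "(1 - \<epsilon>) * n < card M"
proof (rule ccontr)
  assume "\<not> (1 - \<epsilon>) * n < card M"
  then have "\<epsilon> * n \<le> n - real (card M)"
    by (simp add: algebra_simps)
  moreover have M: "matching E M"
    using assms(6) by (simp add: maximal_matching_def)
  ultimately have "(p - \<epsilon>) * (\<epsilon> * n)\<^sup>2 \<le> card {e \<in> E. disjnt e (\<Union>M)}"
    using assms by (intro card_extending_edges_ge[of V]) auto
  moreover have "0 < (p - \<epsilon>) * (\<epsilon> * n)\<^sup>2"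
    using assms by simp
  ultimately have "0 < card {e \<in> E. disjnt e (\<Union>M)}"
    by linarith
  then obtain e where e: "e \<in> E" "disjnt e (\<Union>M)"
    by (metis (mono_tags, lifting) card_gt_0_iff ex_in_conv mem_Collect_eq)
  have "e \<noteq> {}"
    using e bipartition_no_empty_edge[OF assms(2)] by blast
  then have "M \<subset> insert e M"
    using e by (auto simp: disjnt_def)
  then show False
    using matching_insert[OF M e] assms(6) by (auto simp: maximal_matching_def)
qed

text \<open>Passing from size \<open>m\<close> to \<open>Suc m\<close> multiplies the count by at
  least \<open>(p - \<epsilon>) * (\<epsilon> * n)\<^sup>2 / Suc m\<close>, and
  \<open>Suc m \<le> n\<close>. Only the smaller size has to leave \<open>\<epsilon> * n\<close>
  vertices free, which explains the \<open>+ 1\<close> in the bound on \<open>m\<close>.\<close>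

lemma regular_pair_card_matchings_of_size:
  fixes \<epsilon> p :: real
  assumes "simple_graph V E" "bipartition V E X Y" "card X = n" "card Y = n"
    and "regular_pair E X Y \<epsilon> p" and "0 < \<epsilon>" "0 < n" "\<epsilon> < p"
    and "m < (1 - \<epsilon>) * n + 1"
  shows "((p - \<epsilon>) * \<epsilon>\<^sup>2 * n) ^ m \<le> card (matchings_of_size E m)"
  using assms(9)
proof (induction m)
  case 0
  have "matchings_of_size E 0 = {{}}"
    using simple_graph_finite_edges[OF assms(1)] finite_subset
    by (fastforce simp: matchings_of_size_def matching_def)
  then show ?case
    by simp
next
  case (Suc m)
  let ?c = "(p - \<epsilon>) * \<epsilon>\<^sup>2"
  have small: "\<epsilon> * n \<le> n - real m"
    using Suc.prems by (simp add: algebra_simps)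
  have "m < n"
    using small assms(6,7) by (smt (verit) mult_pos_pos of_nat_0_less_iff of_nat_less_iff)
  have "card (matchings_of_size E m) * ((p - \<epsilon>) * (\<epsilon> * n)\<^sup>2)
      \<le> Suc m * card (matchings_of_size E (Suc m))"
    using assms small simple_graph_finite_edges[OF assms(1)] bipartition_no_empty_edge[OF assms(2)]
    by (intro card_matchings_of_size_Suc card_extending_edges_ge[of V])
       (auto simp: matchings_of_size_def)
  also have "\<dots> \<le> n * card (matchings_of_size E (Suc m))"
    using \<open>m < n\<close> by (simp only: of_nat_mult[symmetric] of_nat_le_iff) (rule mult_le_mono1, simp)
  finally have "n * (card (matchings_of_size E m) * (?c * n)) \<le> n * card (matchings_of_size E (Suc m))"
    by (simp add: power2_eq_square algebra_simps)
  then have "card (matchings_of_size E m) * (?c * n) \<le> card (matchings_of_size E (Suc m))"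
    using assms(7) by (metis mult_le_cancel_left_pos of_nat_0_less_iff of_nat_mult)
  moreover have "(?c * n) ^ m * (?c * n) \<le> card (matchings_of_size E m) * (?c * n)"
    using Suc assms by (intro mult_right_mono) auto
  ultimately show ?case
    by (simp add: mult.commute)
qed

section \<open>Counting maximal matchings\<close>

text \<open>Every matching is a subset of a maximal one, and a maximal one has at most
  \<open>card X\<close> edges, hence at most \<open>2 ^ card X\<close> subsets.\<close>

lemma card_matchings_of_size_le_maximal:
  assumes "finite E" "bipartition V E X Y" "finite X"
  shows "card (matchings_of_size E m) \<le> card {M. maximal_matching E M} * 2 ^ card X"
proof -
  let ?S = "{M. maximal_matching E M}"
  have finS: "finite ?S"
    by (rule finite_subset[OF _ finite_matchings[OF assms(1)]]) (auto simp: maximal_matching_def)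
  have max: "matching E M" "finite M" if "M \<in> ?S" for M
    using that assms(1) finite_subset by (auto simp: maximal_matching_def matching_def)
  have "matchings_of_size E m \<subseteq> (\<Union>N\<in>?S. Pow N)"
    using matching_extends_to_maximal[OF assms(1)] by (auto simp: matchings_of_size_def) metis
  then have "card (matchings_of_size E m) \<le> card (\<Union>N\<in>?S. Pow N)"
    using finS max by (intro card_mono) auto
  also have "\<dots> \<le> (\<Sum>N\<in>?S. card (Pow N))"
    using finS by (rule card_UN_le)
  also have "\<dots> \<le> (\<Sum>N\<in>?S. 2 ^ card X)"
  proof (rule sum_mono)
    fix N assume N: "N \<in> ?S"
    have "card N \<le> card X"
      using card_matching_covered[OF assms(1,2) max(1)[OF N]] assms(3)
      by (metis card_mono inf_le1)
    then show "card (Pow N) \<le> 2 ^ card X"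
      using max(2)[OF N] by (simp add: card_Pow)
  qed
  finally show ?thesis
    by simp
qed

lemma ln_NM_le:
  assumes "simple_graph V E" "bipartition V E X Y" "card X = n" "card Y = n" "0 < n"
  shows "ln (real (NM V E \<eta>)) \<le> n * ln (real n + 1)"
\<comment> \<open>Since \<open>ln 0 = 0\<close>, the zero case only asks for a nonnegative
  right-hand side.\<close>
proof (cases "NM V E \<eta> = 0")
  case False
  have finE: "finite E"
    using assms(1) by (rule simple_graph_finite_edges)
  have "NM V E \<eta> \<le> card {M. matching E M}"
    unfolding NM_def using finite_matchings[OF finE]
    by (rule card_mono)
       (auto simp: maximal_near_perfect_matching_def maximal_matching_def)
  also have "\<dots> \<le> Suc n ^ n"
    using card_matchings_le[OF finE assms(2)] assms card_ge_0_finite by metis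
  finally have "real (NM V E \<eta>) \<le> (real n + 1) ^ n"
    by (metis add.commute of_nat_Suc of_nat_le_iff of_nat_power)
  then have "ln (real (NM V E \<eta>)) \<le> ln ((real n + 1) ^ n)"
    using False by (subst ln_le_cancel_iff) auto
  then show ?thesis
    by (simp add: ln_realpow)
qed simp

text \<open>As \<open>card V = 2 * n\<close>, the size condition in \<open>NM\<close> is exactly the
  bound assumed of all maximal matchings.\<close>

lemma NM_eq_card_maximal_matchings:
  fixes \<eta> :: real
  assumes "simple_graph V E" "bipartition V E X Y" "card X = n" "card Y = n"
    and "0 < n" and large: "\<And>M. maximal_matching E M \<Longrightarrow> (1 - \<eta>) * n \<le> card M"
  shows "NM V E \<eta> = card {M. maximal_matching E M}"
proof -
  have "finite X" "finite Y"
    using assms(3-5) card_ge_0_finite by metis+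
  then have "card V = 2 * n"
    using assms(2-4) card_Un_disjoint[of X Y] by (auto simp: bipartition_def)
  then show ?thesis
    using large by (auto simp: NM_def maximal_near_perfect_matching_def intro!: arg_cong[of _ _ card])
qed

lemma card_maximal_matchings_pos:
  assumes "finite E"
  shows "0 < card {M. maximal_matching E M}"
proof -
  have "finite {M. maximal_matching E M}"
    by (rule finite_subset[OF _ finite_matchings[OF assms]]) (auto simp: maximal_matching_def)
  moreover have "matching E {}"
    by (simp add: matching_def)
  ultimately show ?thesis
    using matching_extends_to_maximal[OF assms] by (metis card_gt_0_iff empty_iff mem_Collect_eq)
qed

lemma regular_pair_ln_card_maximal_matchings:
  fixes \<epsilon> p :: real
  assumes "simple_graph V E" "bipartition V E X Y" "card X = n" "card Y = n"
    and "regular_pair E X Y \<epsilon> p" and "0 < \<epsilon>" "\<epsilon> < 1" "0 < n" "\<epsilon> < p"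
    and "1 \<le> (p - \<epsilon>) * \<epsilon>\<^sup>2 * n"
  shows "n * ((1 - \<epsilon>) * ln ((p - \<epsilon>) * \<epsilon>\<^sup>2 * n) - ln 2) \<le> ln (card {M. maximal_matching E M})"
proof -
  \<comment> \<open>Rounding up gives the exponent at least \<open>(1 - \<epsilon>) * n\<close> and
    stays within the range of the counting lemma.\<close>
  define m where "m = nat \<lceil>(1 - \<epsilon>) * n\<rceil>"
  let ?a = "(p - \<epsilon>) * \<epsilon>\<^sup>2 * n" and ?N = "card {M. maximal_matching E M}"
  have finE: "finite E"
    using assms(1) by (rule simple_graph_finite_edges)
  have "0 \<le> (1 - \<epsilon>) * n"
    using assms by simp
  then have m: "(1 - \<epsilon>) * n \<le> m" "m < (1 - \<epsilon>) * n + 1"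
    unfolding m_def by linarith+
  have "?a ^ m \<le> card (matchings_of_size E m)"
    using assms m(2) by (intro regular_pair_card_matchings_of_size) auto
  also have "\<dots> \<le> real (?N * 2 ^ n)"
    using card_matchings_of_size_le_maximal[OF finE assms(2)] assms card_ge_0_finite
    by (metis of_nat_le_iff)
  finally have "?a ^ m \<le> real ?N * 2 ^ n"
    by simp
  moreover have "0 < ?a ^ m"
    using assms(10) by simp
  ultimately have "ln (?a ^ m) \<le> ln (real ?N * 2 ^ n)"
    by (metis ln_le_cancel_iff order_less_le_trans)
  moreover have "ln (?a ^ m) = m * ln ?a"
    using assms(10) by (simp add: ln_realpow)
  moreover have "ln (real ?N * 2 ^ n) = ln ?N + n * ln 2"
    using card_maximal_matchings_pos[OF finE] by (subst ln_mult_pos) (auto simp: ln_realpow)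
  \<comment> \<open>Lowering the exponent is safe because \<open>1 \<le> ?a\<close> makes the
    logarithm nonnegative.\<close>
  moreover have "(1 - \<epsilon>) * n * ln ?a \<le> m * ln ?a"
    using m(1) assms(10) by (intro mult_right_mono) auto
  ultimately show ?thesis
    by (simp add: algebra_simps)
qed

section \<open>Asymptotic comparison and the theorem\<close>

text \<open>The gap \<open>(b - a) * ln n\<close> tends to infinity and absorbs the constants coming
  from \<open>c\<close>, \<open>d\<close> and \<open>K\<close>; \<open>a\<close> may be negative, as
  \<open>1 - 3 * sqrt \<epsilon>\<close> can be.\<close>

lemma eventually_ln_mult_le:
  fixes a b c d K :: real
  assumes "0 < c" "0 < d" "a < b"
  shows "eventually (\<lambda>n::nat. a * ln (c * n) + K \<le> b * ln (d * n)) sequentially"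
proof -
  have "eventually (\<lambda>n::nat. a * ln c + K - b * ln d \<le> (b - a) * ln n) sequentially"
    using assms by real_asymp
  then show ?thesis
    using eventually_gt_at_top[of 0]
    by eventually_elim (use assms in \<open>simp add: ln_mult_pos algebra_simps\<close>)
qed

text \<open>If \<open>p \<le> \<epsilon> < 1\<close>, the edgeless graph is regular with density
  \<open>p\<close> but has no near perfect matching, so the lower bound is stated outside this
  range. There \<open>0 < NM\<close> is asserted too, so that the bound does not rest on
  \<open>ln 0 = 0\<close>.\<close>

theorem theorem1p1:
  fixes \<epsilon> p :: real
  assumes "0 < \<epsilon>" and "0 < p" and "p \<le> 1"
  shows "\<exists>n0::nat. \<forall>(V::'a set) E X Y (n::nat).
           simple_graph V E \<and> bipartition V E X Y \<and> card X = n \<and> card Y = n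
           \<and> regular_pair E X Y \<epsilon> p \<and> 2 * n > n0 \<longrightarrow>
             (\<epsilon> < p \<or> 1 \<le> \<epsilon> \<longrightarrow>
                0 < NM V E (sqrt \<epsilon>)
                \<and> (1 - 3 * sqrt \<epsilon>) * real n * ln (p * real n) \<le> ln (real (NM V E (sqrt \<epsilon>))))
             \<and> ln (real (NM V E (sqrt \<epsilon>))) \<le> (1 + 3 * sqrt \<epsilon>) * real n * ln (p * real n)"
proof -
  let ?c = "(p - \<epsilon>) * \<epsilon>\<^sup>2"
  have up: "eventually (\<lambda>n::nat. ln (real n + 1) \<le> (1 + 3 * sqrt \<epsilon>) * ln (p * n)) sequentially"
  proof -
    have "eventually (\<lambda>n::nat. 1 * ln (2 * n) + 0 \<le> (1 + 3 * sqrt \<epsilon>) * ln (p * n)) sequentially"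
      using assms by (intro eventually_ln_mult_le) auto
    then show ?thesis
      using eventually_gt_at_top[of 0]
    proof eventually_elim
      case (elim n)
      then have "ln (real n + 1) \<le> ln (2 * real n)"
        by (subst ln_le_cancel_iff) auto
      with elim show ?case
        by linarith
    qed
  qed
  have low: "eventually (\<lambda>n::nat. \<epsilon> < p \<longrightarrow> 1 \<le> ?c * n \<and>
      (1 - 3 * sqrt \<epsilon>) * ln (p * n) \<le> (1 - \<epsilon>) * ln (?c * n) - ln 2) sequentially"
  proof (cases "\<epsilon> < p")
    case True
    then have c: "0 < ?c"
      using assms by simp
    \<comment> \<open>From \<open>\<epsilon> < p \<le> 1\<close>; it makes
      \<open>1 - 3 * sqrt \<epsilon>\<close> strictly smaller than \<open>1 - \<epsilon>\<close>,
      the slack that pays for \<open>ln 2\<close> and \<open>?c\<close>.\<close>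
    have "\<epsilon> < 3 * sqrt \<epsilon>"
      using assms True by (smt (verit) real_sqrt_ge_one real_sqrt_gt_zero real_le_lsqrt
          real_le_rsqrt power2_eq_square mult_left_le)
    then have "eventually (\<lambda>n::nat. (1 - 3 * sqrt \<epsilon>) * ln (p * n) + ln 2 \<le> (1 - \<epsilon>) * ln (?c * n))
        sequentially"
      using assms c by (intro eventually_ln_mult_le) auto
    moreover have "eventually (\<lambda>n::nat. 1 \<le> ?c * n) sequentially"
      using c by real_asymp
    ultimately show ?thesis
      by eventually_elim simp
  qed simp
  have "eventually (\<lambda>n::nat. 1 \<le> p * n) sequentially"
    using assms by real_asymp
  with up low have "eventually (\<lambda>n::nat. 0 < n \<and> 1 \<le> p * n
      \<and> ln (real n + 1) \<le> (1 + 3 * sqrt \<epsilon>) * ln (p * n)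
      \<and> (\<epsilon> < p \<longrightarrow> 1 \<le> ?c * n \<and>
          (1 - 3 * sqrt \<epsilon>) * ln (p * n) \<le> (1 - \<epsilon>) * ln (?c * n) - ln 2)) sequentially"
    using eventually_gt_at_top[of 0] by eventually_elim auto
  then obtain n1 where n1: "\<And>n. n1 \<le> n \<Longrightarrow> 0 < n \<and> 1 \<le> p * n
      \<and> ln (real n + 1) \<le> (1 + 3 * sqrt \<epsilon>) * ln (p * n)
      \<and> (\<epsilon> < p \<longrightarrow> 1 \<le> ?c * n \<and>
          (1 - 3 * sqrt \<epsilon>) * ln (p * n) \<le> (1 - \<epsilon>) * ln (?c * n) - ln 2)"
    unfolding eventually_sequentially by blast
  show ?thesis
  proof (intro exI[of _ "2 * n1"] allI impI)
    fix V :: "'a set" and E X Y and n :: nat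
    assume asm: "simple_graph V E \<and> bipartition V E X Y \<and> card X = n \<and> card Y = n
           \<and> regular_pair E X Y \<epsilon> p \<and> 2 * n > 2 * n1"
    then have G: "simple_graph V E" "bipartition V E X Y" "card X = n" "card Y = n"
        "regular_pair E X Y \<epsilon> p" and "n1 \<le> n"
      by auto
    note n = n1[OF \<open>n1 \<le> n\<close>]
    note pos = card_maximal_matchings_pos[OF simple_graph_finite_edges[OF G(1)]]
    have "0 < NM V E (sqrt \<epsilon>) \<and>
        (1 - 3 * sqrt \<epsilon>) * real n * ln (p * real n) \<le> ln (real (NM V E (sqrt \<epsilon>)))"
      if "1 \<le> \<epsilon>"
    proof -
      have root: "1 \<le> sqrt \<epsilon>"
        using that by simp
      \<comment> \<open>The size threshold is not positive here, so all maximal matchings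
        count.\<close>
      have "(1 - sqrt \<epsilon>) * n \<le> card M" for M :: "'a set set"
        using root by (smt (verit) mult_nonpos_nonneg of_nat_0_le_iff)
      then have eq: "NM V E (sqrt \<epsilon>) = card {M. maximal_matching E M}"
        using n by (intro NM_eq_card_maximal_matchings[OF G(1-4)]) auto
      \<comment> \<open>A negative coefficient meets \<open>ln (p * n) \<ge> 0\<close>, while the
        logarithm of a positive count is nonnegative.\<close>
      have "(1 - 3 * sqrt \<epsilon>) * real n * ln (p * real n) \<le> 0"
        using n by (intro mult_nonpos_nonneg ln_ge_zero) (use root in linarith, simp_all)
      also have "0 \<le> ln (real (NM V E (sqrt \<epsilon>)))"
        using pos eq by simp
      finally show ?thesis
        using pos eq by simp
    qed
    moreover have "0 < NM V E (sqrt \<epsilon>) \<and>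
        (1 - 3 * sqrt \<epsilon>) * real n * ln (p * real n) \<le> ln (real (NM V E (sqrt \<epsilon>)))"
      if "\<epsilon> < p" "\<epsilon> < 1"
    proof -
      \<comment> \<open>The size \<open>(1 - \<epsilon>) * n\<close> forced by regularity thus
        exceeds the required \<open>(1 - sqrt \<epsilon>) * n\<close>.\<close>
      have "\<epsilon> \<le> sqrt \<epsilon>"
        using assms(1) that(2) by (intro real_le_rsqrt) (simp add: power2_eq_square)
      then have "(1 - sqrt \<epsilon>) * n \<le> (1 - \<epsilon>) * n"
        by (intro mult_right_mono) auto
      then have "(1 - sqrt \<epsilon>) * n \<le> card M" if "maximal_matching E M" for M
        using regular_pair_maximal_matching_large[OF G that] assms(1) n \<open>\<epsilon> < p\<close> by linarith
      then have eq: "NM V E (sqrt \<epsilon>) = card {M. maximal_matching E M}"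
        using n by (intro NM_eq_card_maximal_matchings[OF G(1-4)]) auto
      have "n * ((1 - 3 * sqrt \<epsilon>) * ln (p * n)) \<le> n * ((1 - \<epsilon>) * ln (?c * n) - ln 2)"
        using n that by (intro mult_left_mono) auto
      also have "\<dots> \<le> ln (card {M. maximal_matching E M})"
        using assms that n by (intro regular_pair_ln_card_maximal_matchings[OF G]) auto
      finally show ?thesis
        using pos eq by (simp add: mult_ac)
    qed
    moreover have "ln (real (NM V E (sqrt \<epsilon>))) \<le> (1 + 3 * sqrt \<epsilon>) * real n * ln (p * real n)"
    proof -
      have "ln (real (NM V E (sqrt \<epsilon>))) \<le> n * ln (real n + 1)"
        using n by (intro ln_NM_le[OF G(1-4)]) auto
      also have "\<dots> \<le> n * ((1 + 3 * sqrt \<epsilon>) * ln (p * n))"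
        using n by (intro mult_left_mono) auto
      finally show ?thesis
        by (simp add: mult_ac)
    qed
    ultimately show "(\<epsilon> < p \<or> 1 \<le> \<epsilon> \<longrightarrow>
                0 < NM V E (sqrt \<epsilon>)
                \<and> (1 - 3 * sqrt \<epsilon>) * real n * ln (p * real n) \<le> ln (real (NM V E (sqrt \<epsilon>))))
             \<and> ln (real (NM V E (sqrt \<epsilon>))) \<le> (1 + 3 * sqrt \<epsilon>) * real n * ln (p * real n)"
      by linarith
  qed
qed

end
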